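(* Assume A1--A4. Let $\{(x_k,z_k,\lambda_k,\mu_k)\}_{k\in\mathbb{N}}$ be the sequence generated by Algorithm 1. Then the sequence $\{\mathcal{L}_\beta(x_k,z_k,\lambda_k,\mu_k)\}_{k\in\mathbb{N}}$ is convergent, i.e. there is a finite value $\underline{\mathcal{L}_\beta}>-\infty$ with $$\lim_{k\to\infty}\mathcal{L}_\beta(x_k,z_k,\lambda_k,\mu_k)=\underline{\mathcal{L}_\beta}.$$ Furthermore, the sequence $\{(x_k,z_k,\lambda_k,\mu_k)\}_{k\in\mathbb{N}}$ is bounded.
   Context: Problem (P): $\min_{x\in\mathbb{R}^n} f(x)$ subject to $c(x)=0$, $x\in X$, where $f:\mathbb{R}^n\to\mathbb{R}$ and $c=(c_1,\dots,c_m):\mathbb{R}^n\to\mathbb{R}^m$ are continuously differentiable and possibly nonconvex, and $X\subseteq\mathbb{R}^n$ is nonempty, closed and convex. $\|\cdot\|$ is the Euclidean norm, $\mathbb{N}=\{0,1,2,\dots\}$, and $\mathrm{P}_X$ is the Euclidean projection onto $X$. Assumptions: (A1) $\nabla f$ is $L_{\nabla f}$-Lipschitz continuous over $X$. (A2) The Jacobian $\nabla c$ is $L_{\nabla c}$-Lipschitz continuous over $X$. (A3) $c$ is $L_c$-Lipschitz continuous over $X$. (A4) $X$ is bounded (and thus compact), or, otherwise, $f$ is coercive and lower bounded over $X$. Proximal-Perturbed Lagrangian: for $x\in\mathbb{R}^n$ and $z,\lambda,\mu\in\mathbb{R}^m$, with parameters $\alpha,\beta>0$, $$\mathcal{L}_\beta(x,z,\lambda,\mu)=f(x)+\langle\lambda,c(x)-z\rangle+\langle\mu,z\rangle+\tfrac{\alpha}{2}\|z\|^2-\tfrac{\beta}{2}\|\lambda-\mu\|^2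 .$$ $L_p>0$ denotes a Lipschitz constant over $X$ of $x\mapsto\nabla_x\mathcal{L}_\beta(x,z,\lambda,\mu)$ with $(z,\lambda,\mu)$ fixed; in Algorithm 1 it is a constant valid for $(z,\lambda,\mu)=(z_k,\lambda_k,\mu_k)$ for every $k$. Algorithm 1. Input: $\alpha>1$ (chosen large), $\beta\in(0,1)$, $\rho:=\frac{\alpha}{1+\alpha\beta}$, $\eta>L_p+2\rho L_c^2$, $r\in(0,1)$, an initial point $(x_0,z_0,\lambda_0,\mu_0)$, and $\delta_0\in(0,1]$. For $k=0,1,2,\dots$: $x_{k+1}=\mathrm{P}_X[x_k-\eta^{-1}\nabla_x\mathcal{L}_\beta(x_k,z_k,\lambda_k,\mu_k)]$; $\mu_{k+1}=\mu_k+\frac{\gamma_k}{\rho}(\lambda_k-\mu_k)$ with $\gamma_k=\frac{\rho\delta_k}{\|\lambda_k-\mu_k\|^2+1}$; $\lambda_{k+1}=\mu_{k+1}+\rho c(x_{k+1})$; $z_{k+1}=\frac1\alpha(\lambda_{k+1}-\mu_{k+1})$; $\delta_{k+1}=r\delta_k$. *)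

theory Defs
  imports "HOL-Analysis.Analysis"
begin

definition gradient :: "('a::real_inner \<Rightarrow> real) \<Rightarrow> 'a \<Rightarrow> 'a" where
  "gradient f x = (THE D. GDERIV f x :> D)"

lemma gradient_eqI:
  assumes "GDERIV f x :> D"
  shows "gradient f x = D"
  unfolding gradient_def
proof (rule the_equality)
  show "GDERIV f x :> D" by fact
next
  fix E assume "GDERIV f x :> E"
  with assms have "(\<lambda>h. inner h E) = (\<lambda>h. inner h D)"
    unfolding gderiv_def by (blast intro: has_derivative_unique)
  then have "inner (E - D) E = inner (E - D) D" by metis
  then have "inner (E - D) (E - D) = 0" by (simp add: inner_diff_right)
  then show "E = D" by simp
qed

definition C1_scalar :: "('a::real_inner \<Rightarrow> real) \<Rightarrow> bool" where
  "C1_scalar f \<longleftrightarrow> (\<forall>x. f differentiable (at x)) \<and> continuous_on UNIV (gradient f)"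

definition C1_vector :: "(real^'n \<Rightarrow> real^'m) \<Rightarrow> bool" where
  "C1_vector c \<longleftrightarrow> (\<forall>x. c differentiable (at x)) \<and> continuous_on UNIV (\<lambda>x. jacobian c (at x))"

(* The library norm on real^'n^'m is the Frobenius norm. Jacobians are compared here in the
   operator norm induced by the Euclidean norm, which never exceeds the Frobenius norm. *)
definition jacobian_lipschitz_on :: "real \<Rightarrow> (real^'n) set \<Rightarrow> (real^'n \<Rightarrow> real^'m) \<Rightarrow> bool" where
  "jacobian_lipschitz_on L X c \<longleftrightarrow> 0 \<le> L \<and>
     (\<forall>x\<in>X. \<forall>y\<in>X. onorm (\<lambda>h. (jacobian c (at x) - jacobian c (at y)) *v h) \<le> L * dist x y)"

definition coercive_on :: "('a::real_normed_vector) set \<Rightarrow> ('a \<Rightarrow> real) \<Rightarrow> bool" where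
  "coercive_on X f \<longleftrightarrow> filterlim f at_top (inf at_infinity (principal X))"

definition pp_lagrangian ::
  "('a \<Rightarrow> real) \<Rightarrow> ('a \<Rightarrow> 'b::real_inner) \<Rightarrow> real \<Rightarrow> real \<Rightarrow> 'a \<Rightarrow> 'b \<Rightarrow> 'b \<Rightarrow> 'b \<Rightarrow> real" where
  "pp_lagrangian f c \<alpha> \<beta> x z lam mu =
     f x + inner lam (c x - z) + inner mu z + \<alpha> / 2 * (norm z)\<^sup>2 - \<beta> / 2 * (norm (lam - mu))\<^sup>2"

definition grad_x_lagrangian ::
  "('a::real_inner \<Rightarrow> real) \<Rightarrow> ('a \<Rightarrow> 'b::real_inner) \<Rightarrow> real \<Rightarrow> real \<Rightarrow> 'a \<Rightarrow> 'b \<Rightarrow> 'b \<Rightarrow> 'b \<Rightarrow> 'a" where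
  "grad_x_lagrangian f c \<alpha> \<beta> x z lam mu = gradient (\<lambda>y. pp_lagrangian f c \<alpha> \<beta> y z lam mu) x"

definition pp_rho :: "real \<Rightarrow> real \<Rightarrow> real" where
  "pp_rho \<alpha> \<beta> = \<alpha> / (1 + \<alpha> * \<beta>)"

(* The recursion only; the initial point and the ranges of the parameters are left open. *)
definition pp_iterates ::
  "('a::euclidean_space \<Rightarrow> real) \<Rightarrow> ('a \<Rightarrow> 'b::real_inner) \<Rightarrow> 'a set \<Rightarrow>
   real \<Rightarrow> real \<Rightarrow> real \<Rightarrow> real \<Rightarrow> (nat \<Rightarrow> real) \<Rightarrow>
   (nat \<Rightarrow> 'a) \<Rightarrow> (nat \<Rightarrow> 'b) \<Rightarrow> (nat \<Rightarrow> 'b) \<Rightarrow> (nat \<Rightarrow> 'b) \<Rightarrow> bool" where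
  "pp_iterates f c X \<alpha> \<beta> \<eta> r \<delta> x z lam mu \<longleftrightarrow>
     (\<forall>k. let \<rho> = pp_rho \<alpha> \<beta>;
              \<gamma> = \<rho> * \<delta> k / ((norm (lam k - mu k))\<^sup>2 + 1)
          in x (Suc k) = closest_point X
                (x k - (1 / \<eta>) *\<^sub>R grad_x_lagrangian f c \<alpha> \<beta> (x k) (z k) (lam k) (mu k)) \<and>
             mu (Suc k) = mu k + (\<gamma> / \<rho>) *\<^sub>R (lam k - mu k) \<and>
             lam (Suc k) = mu (Suc k) + \<rho> *\<^sub>R c (x (Suc k)) \<and>
             z (Suc k) = (1 / \<alpha>) *\<^sub>R (lam (Suc k) - mu (Suc k)) \<and>
             \<delta> (Suc k) = r * \<delta> k)"

end

theory Submission
  imports Defs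
begin

text \<open>
  Once $k \ge 1$, the updates of $\lambda$ and $z$ tie $\lambda_k - \mu_k = \rho c(x_k)$ and
  $\alpha z_k = \rho c(x_k)$. Since $1/\rho = 1/\alpha + \beta$, all quadratic terms of the
  proximal-perturbed Lagrangian then collapse and its value is that of the classical augmented
  Lagrangian
  $$\Phi(x_k, \mu_k) = f(x_k) + \langle \mu_k, c(x_k)\rangle + \frac{\rho}{2} \|c(x_k)\|^2$$
  (\<open>pp_lagrangian_eq_augmented\<close>), whose partial gradient at $(x_k, \mu_k)$ is exactly the direction
  used in the primal step.

  The primal step therefore decreases $\Phi$ by a multiple of $\|x_{k+1} - x_k\|^2$, by the descent
  inequality for projected gradient steps (\<open>projected_gradient_step_decrease\<close>). The dual step can only
  spoil this by $\langle \mu_{k+1} - \mu_k, c(x_{k+1})\rangle$, and the normalisation of the dual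
  step length makes this at most a constant times $\delta_k$ plus a small multiple of
  $\|x_{k+1} - x_k\|^2$ that the primal decrease absorbs
  (\<open>normalised_multiplier_perturbation\<close>). This estimate is uniform in the size of $c(x_k)$, so boundedness of
  the iterates can be deduced from it afterwards. Altogether $\Phi$ increases per step by at most
  $\frac{5}{4\rho} \delta_k$ (\<open>augmented_lagrangian_step\<close>), which is summable because
  $\delta_k = r^k \delta_0$.

  The same normalisation gives $\|\mu_{k+1} - \mu_k\| \le \delta_k$, so the multipliers are bounded.
  Completing the square, $\Phi(x, \mu) \ge f(x) - \|\mu\|^2 / (2\rho)$, and the assumptions on $f$ and
  $X$ bound $f$ below. So $\Phi$ along the iterates is bounded below and decreasing up to summable
  errors, hence convergent; in particular it is bounded above, so the $x_k$ stay in a sublevel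
  set of $f$ on $X$, which is bounded. Boundedness of $\lambda_k$ and $z_k$ follows, because they are
  expressed through $\mu_k$ and $c(x_k)$.
\<close>

section \<open>Gradients and projected gradient steps\<close>

lemma GDERIV_gradient:
  fixes f :: "'a::euclidean_space \<Rightarrow> real"
  assumes "f differentiable (at x)"
  shows "GDERIV f x :> gradient f x"
proof -
  obtain f' where f': "(f has_derivative f') (at x)"
    using assms unfolding differentiable_def by blast
  interpret linear f' using f' by (rule has_derivative_linear)
  \<comment> \<open>The adjoint represents the linear functional by an inner product.\<close>
  have "f' = (\<lambda>h. inner h (adjoint f' 1))"
    using adjoint_works[OF linear_axioms, of _ 1] by (auto simp: fun_eq_iff)
  with f' have "GDERIV f x :> adjoint f' 1" by (simp add: gderiv_def)
  then show ?thesis using gradient_eqI by metis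
qed

text \<open>The quadratic upper bound given by a Lipschitz gradient: along the segment from $x$ to $y$ the
  function minus its bound has nonpositive derivative, and it vanishes at $x$.\<close>

lemma lipschitz_gradient_quadratic_bound:
  fixes \<phi> :: "'a::euclidean_space \<Rightarrow> real"
  assumes "convex X" and x: "x \<in> X" and y: "y \<in> X"
    and deriv: "\<And>u. GDERIV \<phi> u :> g u"
    and lip: "L-lipschitz_on X g"
  shows "\<phi> y \<le> \<phi> x + inner (g x) (y - x) + L / 2 * (norm (y - x))\<^sup>2"
proof -
  define d where "d = y - x"
  define h where "h t = \<phi> (x + t *\<^sub>R d) - t * inner (g x) d - L / 2 * t\<^sup>2 * (norm d)\<^sup>2" for t
  have h': "(h has_real_derivative
      inner d (g (x + t *\<^sub>R d)) - inner (g x) d - L * t * (norm d)\<^sup>2) (at t)" for t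
  proof -
    have line: "((\<lambda>t. x + t *\<^sub>R d) has_derivative (\<lambda>s. s *\<^sub>R d)) (at t)"
      by (auto intro!: derivative_eq_intros)
    have "((\<lambda>t. \<phi> (x + t *\<^sub>R d)) has_derivative (\<lambda>s. inner (s *\<^sub>R d) (g (x + t *\<^sub>R d)))) (at t)"
      using has_derivative_compose[OF line deriv[unfolded gderiv_def]] .
    then have *: "((\<lambda>t. \<phi> (x + t *\<^sub>R d)) has_real_derivative inner d (g (x + t *\<^sub>R d))) (at t)"
      by (simp add: has_field_derivative_def mult.commute[of _ "inner d _"])
    show ?thesis unfolding h_def
      by (auto intro!: derivative_eq_intros * simp: algebra_simps)
  qed
  have nonpos: "inner d (g (x + t *\<^sub>R d)) - inner (g x) d - L * t * (norm d)\<^sup>2 \<le> 0"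
    if t: "0 \<le> t" "t \<le> 1" for t
  proof -
    have "x + t *\<^sub>R d = (1 - t) *\<^sub>R x + t *\<^sub>R y" by (simp add: d_def algebra_simps)
    then have "x + t *\<^sub>R d \<in> X" using convexD_alt[OF \<open>convex X\<close> x y t] by simp
    then have "norm (g (x + t *\<^sub>R d) - g x) \<le> L * (t * norm d)"
      using lipschitz_onD[OF lip _ x] t by (fastforce simp: dist_norm)
    then have "norm d * norm (g (x + t *\<^sub>R d) - g x) \<le> norm d * (L * (t * norm d))"
      by (rule mult_left_mono) simp
    moreover have "inner d (g (x + t *\<^sub>R d)) - inner (g x) d = inner d (g (x + t *\<^sub>R d) - g x)"
      by (simp add: inner_diff_right inner_commute)
    ultimately show ?thesis
      using norm_cauchy_schwarz[of d "g (x + t *\<^sub>R d) - g x"]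
      by (simp add: power2_eq_square algebra_simps)
  qed
  have "h 1 \<le> h 0"
    by (rule DERIV_nonpos_imp_nonincreasing[of 0 1]) (use h' nonpos in \<open>auto intro!: exI\<close>)
  then show ?thesis by (simp add: h_def d_def)
qed

lemma projected_gradient_step_decrease:
  fixes \<phi> :: "'a::euclidean_space \<Rightarrow> real"
  assumes "convex X" "closed X" and x: "x \<in> X"
    and deriv: "\<And>u. GDERIV \<phi> u :> g u"
    and lip: "L-lipschitz_on X g"
    and "\<eta> > 0"
    and y: "y = closest_point X (x - (1 / \<eta>) *\<^sub>R g x)"
  shows "\<phi> y \<le> \<phi> x - (\<eta> - L / 2) * (norm (y - x))\<^sup>2"
proof -
  have "y \<in> X" using closest_point_in_set[OF \<open>closed X\<close>] x y by auto
  then have bound: "\<phi> y \<le> \<phi> x + inner (g x) (y - x) + L / 2 * (norm (y - x))\<^sup>2"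
    using lipschitz_gradient_quadratic_bound[OF \<open>convex X\<close> x _ deriv lip] by blast
  \<comment> \<open>The obtuse angle property of the projection, tested against the point \<open>x\<close> itself.\<close>
  have "inner (x - (1 / \<eta>) *\<^sub>R g x - y) (x - y) \<le> 0"
    unfolding y by (rule closest_point_dot[OF \<open>convex X\<close> \<open>closed X\<close> x])
  moreover have "inner (x - (1 / \<eta>) *\<^sub>R g x - y) (x - y)
      = (norm (y - x))\<^sup>2 + inner (g x) (y - x) / \<eta>"
    by (simp add: power2_norm_eq_inner inner_diff_left inner_diff_right inner_commute
        diff_divide_distrib)
  ultimately have "(norm (y - x))\<^sup>2 + inner (g x) (y - x) / \<eta> \<le> 0" by linarith
  then have "inner (g x) (y - x) \<le> - \<eta> * (norm (y - x))\<^sup>2"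
    using \<open>\<eta> > 0\<close> by (simp add: field_simps)
  with bound show ?thesis by (simp add: algebra_simps)
qed

section \<open>Reduction to the augmented Lagrangian\<close>

definition augmented_lagrangian ::
  "('a \<Rightarrow> real) \<Rightarrow> ('a \<Rightarrow> 'b::real_inner) \<Rightarrow> real \<Rightarrow> 'a \<Rightarrow> 'b \<Rightarrow> real" where
  "augmented_lagrangian f c \<rho> x mu = f x + inner mu (c x) + \<rho> / 2 * (norm (c x))\<^sup>2"

lemma pp_rho_pos: "\<alpha> > 0 \<Longrightarrow> \<beta> > 0 \<Longrightarrow> pp_rho \<alpha> \<beta> > 0"
  unfolding pp_rho_def by (intro divide_pos_pos add_pos_pos mult_pos_pos) auto

lemma pp_lagrangian_eq_augmented:
  assumes "\<alpha> > 0" "\<beta> > 0"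
    and lam: "lam = mu + pp_rho \<alpha> \<beta> *\<^sub>R c x"
    and z: "z = (1 / \<alpha>) *\<^sub>R (lam - mu)"
  shows "pp_lagrangian f c \<alpha> \<beta> x z lam mu = augmented_lagrangian f c (pp_rho \<alpha> \<beta>) x mu"
proof -
  define \<rho> where "\<rho> = pp_rho \<alpha> \<beta>"
  define N where "N = inner (c x) (c x)"
  have pos: "1 + \<alpha> * \<beta> > 0" using assms by (simp add: add_pos_pos)
  have eq: "\<rho> / \<alpha> + \<rho> * \<beta> = 1"
    using pos \<open>\<alpha> > 0\<close> by (simp add: \<rho>_def pp_rho_def add_divide_distrib[symmetric] mult.commute)
  have lhs: "pp_lagrangian f c \<alpha> \<beta> x z lam mu
      = f x + inner mu (c x) + \<rho> * N - \<rho> * (\<rho> / \<alpha>) * N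
        + \<alpha> / 2 * (\<rho> / \<alpha>)\<^sup>2 * N - \<beta> / 2 * \<rho>\<^sup>2 * N"
    unfolding pp_lagrangian_def z lam \<rho>_def[symmetric] power2_norm_eq_inner
    by (simp add: N_def inner_add_left inner_diff_right power2_eq_square algebra_simps)
  have "\<alpha> / 2 * (\<rho> / \<alpha>)\<^sup>2 = \<rho> * (\<rho> / \<alpha>) / 2"
    using \<open>\<alpha> > 0\<close> by (simp add: power2_eq_square)
  then have "pp_lagrangian f c \<alpha> \<beta> x z lam mu
      = f x + inner mu (c x) + \<rho> * N - \<rho> / 2 * (\<rho> / \<alpha> + \<rho> * \<beta>) * N"
    unfolding lhs by (simp only: ) (simp add: field_simps power2_eq_square)
  then show ?thesis
    unfolding eq augmented_lagrangian_def \<rho>_def[symmetric] power2_norm_eq_inner N_def by simp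
qed

text \<open>Completing the square in $c(x)$.\<close>

lemma augmented_lagrangian_ge:
  assumes "\<rho> > 0"
  shows "f x - (norm mu)\<^sup>2 / (2 * \<rho>) \<le> augmented_lagrangian f c \<rho> x mu"
proof -
  have "0 \<le> (norm (mu + \<rho> *\<^sub>R c x))\<^sup>2 / (2 * \<rho>)" using assms by simp
  also have "(norm (mu + \<rho> *\<^sub>R c x))\<^sup>2 = (norm mu)\<^sup>2 + 2 * \<rho> * inner mu (c x) + \<rho>\<^sup>2 * (norm (c x))\<^sup>2"
    unfolding power2_norm_eq_inner
    by (simp add: inner_add_left inner_add_right inner_commute power2_eq_square algebra_simps)
  finally show ?thesis
    using assms by (simp add: augmented_lagrangian_def field_simps power2_eq_square)
qed

section \<open>One iteration\<close>

lemma norm_normalised_le: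
  fixes w :: "'b::real_normed_vector"
  shows "norm w / ((norm w)\<^sup>2 + 1) \<le> 1 / 2"
proof -
  have pos: "(norm w)\<^sup>2 + 1 > 0" by (rule add_nonneg_pos) auto
  have "0 \<le> (norm w - 1)\<^sup>2" by simp
  then show ?thesis
    unfolding pos_divide_le_eq[OF pos] by (simp add: power2_eq_square algebra_simps)
qed

text \<open>In the application $u$ and $v$ are the old and new constraint values and $w = \lambda - \mu$, so
  the left-hand side is the change of the linear term caused by the dual step. The part along $u$ is
  harmless since $\|w\|^2/(\|w\|^2+1) \le 1$, whatever the size of $u$; the rest is of order
  $\|v - u\|$ and is split by Young's inequality, weighted by $\rho$ so that its quadratic part fits
  into the decrease provided by the step size condition.\<close>

lemma normalised_multiplier_perturbation:
  fixes u v :: "'b::real_inner"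
  assumes "\<rho> > 0" and w: "w = \<rho> *\<^sub>R u"
  shows "inner ((1 / ((norm w)\<^sup>2 + 1)) *\<^sub>R w) v \<le> 5 / (4 * \<rho>) + \<rho> / 4 * (norm (v - u))\<^sup>2"
proof -
  define q where "q = (norm w)\<^sup>2 + 1"
  have q: "q > 0" unfolding q_def by (rule add_nonneg_pos) auto
  have "inner w u = (norm w)\<^sup>2 / \<rho>"
    unfolding power2_norm_eq_inner using \<open>\<rho> > 0\<close> by (simp add: w)
  then have "inner w u / q = ((norm w)\<^sup>2 / q) / \<rho>" by simp
  also have "\<dots> \<le> 1 / \<rho>"
    by (rule divide_right_mono) (use q \<open>\<rho> > 0\<close> in \<open>auto simp: q_def\<close>)
  finally have along: "inner w u / q \<le> 1 / \<rho>" .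
  have "inner w (v - u) / q \<le> norm w * norm (v - u) / q"
    using q by (intro divide_right_mono norm_cauchy_schwarz) auto
  also have "\<dots> = (norm w / q) * norm (v - u)" by simp
  also have "\<dots> \<le> 1 / 2 * norm (v - u)"
    unfolding q_def by (intro mult_right_mono norm_normalised_le) auto
  also have "\<dots> \<le> 1 / (4 * \<rho>) + \<rho> / 4 * (norm (v - u))\<^sup>2"
  proof -
    have "0 \<le> (\<rho> * norm (v - u) - 1)\<^sup>2 / (4 * \<rho>)" using \<open>\<rho> > 0\<close> by simp
    then show ?thesis using \<open>\<rho> > 0\<close> by (simp add: field_simps power2_eq_square)
  qed
  finally have across: "inner w (v - u) / q \<le> 1 / (4 * \<rho>) + \<rho> / 4 * (norm (v - u))\<^sup>2" .
  have "inner ((1 / q) *\<^sub>R w) v = inner w u / q + inner w (v - u) / q"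
    by (simp add: inner_diff_right diff_divide_distrib)
  also have "\<dots> \<le> 1 / \<rho> + (1 / (4 * \<rho>) + \<rho> / 4 * (norm (v - u))\<^sup>2)"
    using along across by (rule add_mono)
  also have "\<dots> = 5 / (4 * \<rho>) + \<rho> / 4 * (norm (v - u))\<^sup>2"
    using \<open>\<rho> > 0\<close> by (simp add: field_simps)
  finally show ?thesis unfolding q_def .
qed

text \<open>The primal step is a projected gradient step for the Lagrangian with $\lambda$ held fixed. Passing
  from $\langle\lambda, c\rangle$ to the augmented Lagrangian costs exactly
  $\frac{\rho}{2}\|c(y) - c(x)\|^2$, which is again controlled by $\|y - x\|^2$.\<close>

lemma augmented_lagrangian_step:
  fixes f :: "'a::euclidean_space \<Rightarrow> real" and c :: "'a \<Rightarrow> 'b::real_inner"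
  assumes "convex X" "closed X" and x: "x \<in> X"
    and f: "\<And>u. f differentiable (at u)" and c: "\<And>u. c differentiable (at u)"
    and lip_c: "L_c-lipschitz_on X c"
    and lip: "L_p-lipschitz_on X (\<lambda>y. grad_x_lagrangian f c \<alpha> \<beta> y z lam mu)"
    and "\<rho> > 0" and \<eta>: "\<eta> > L_p + 2 * \<rho> * L_c\<^sup>2"
    and \<delta>: "0 \<le> \<delta>" "\<delta> \<le> 1"
    and lam: "lam = mu + \<rho> *\<^sub>R c x"
    and y: "y = closest_point X (x - (1 / \<eta>) *\<^sub>R grad_x_lagrangian f c \<alpha> \<beta> x z lam mu)"
    and mu': "mu' = mu + (\<delta> / ((norm (lam - mu))\<^sup>2 + 1)) *\<^sub>R (lam - mu)"
  shows "augmented_lagrangian f c \<rho> y mu' \<le> augmented_lagrangian f c \<rho> x mu + 5 / (4 * \<rho>) * \<delta>"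
proof -
  define D where "D = (norm (y - x))\<^sup>2"
  define E where "E = (norm (c y - c x))\<^sup>2"
  have "L_p \<ge> 0" using lip by (rule lipschitz_on_nonneg)
  moreover have sq: "\<rho> * L_c\<^sup>2 \<ge> 0" using \<open>\<rho> > 0\<close> by simp
  ultimately have "\<eta> > 0" using \<eta> by linarith
  have "y \<in> X" using closest_point_in_set[OF \<open>closed X\<close>] x y by auto
  have "norm (c y - c x) \<le> L_c * norm (y - x)"
    using lipschitz_onD[OF lip_c \<open>y \<in> X\<close> x] by (simp add: dist_norm)
  then have E: "E \<le> L_c\<^sup>2 * D"
    unfolding E_def D_def power_mult_distrib[symmetric] by (rule power_mono) simp
  have "E \<ge> 0" "D \<ge> 0" by (simp_all add: E_def D_def)
  have "(\<lambda>y. pp_lagrangian f c \<alpha> \<beta> y z lam mu) differentiable (at u)" for u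
    unfolding pp_lagrangian_def using f[of u] c[of u] by (intro derivative_intros) auto
  then have "GDERIV (\<lambda>y. pp_lagrangian f c \<alpha> \<beta> y z lam mu) u :>
      grad_x_lagrangian f c \<alpha> \<beta> u z lam mu" for u
    unfolding grad_x_lagrangian_def by (rule GDERIV_gradient)
  from projected_gradient_step_decrease[OF \<open>convex X\<close> \<open>closed X\<close> x this lip \<open>\<eta> > 0\<close> y]
  have primal: "f y + inner lam (c y) \<le> f x + inner lam (c x) - (\<eta> - L_p / 2) * D"
    unfolding pp_lagrangian_def D_def by (simp add: inner_diff_right)
  have square: "\<rho> / 2 * (norm (c y))\<^sup>2 + inner mu (c y)
      = inner lam (c y) - \<rho> / 2 * (norm (c x))\<^sup>2 + \<rho> / 2 * E"
    by (simp add: lam E_def power2_norm_eq_inner inner_add_left inner_diff_left inner_diff_right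
        inner_commute algebra_simps)
  have lam_x: "inner lam (c x) = inner mu (c x) + \<rho> * (norm (c x))\<^sup>2"
    by (simp add: lam inner_add_left power2_norm_eq_inner)
  have "inner (mu' - mu) (c y) = \<delta> * inner ((1 / ((norm (lam - mu))\<^sup>2 + 1)) *\<^sub>R (lam - mu)) (c y)"
    by (simp add: mu')
  also have "\<dots> \<le> \<delta> * (5 / (4 * \<rho>) + \<rho> / 4 * E)"
    unfolding E_def using \<delta> lam
    by (intro mult_left_mono normalised_multiplier_perturbation \<open>\<rho> > 0\<close>) auto
  also have "\<dots> \<le> 5 / (4 * \<rho>) * \<delta> + \<rho> / 4 * E"
  proof -
    have "\<delta> * (\<rho> / 4 * E) \<le> 1 * (\<rho> / 4 * E)"
      using \<delta> \<open>\<rho> > 0\<close> \<open>E \<ge> 0\<close> by (intro mult_right_mono) auto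
    then show ?thesis by (simp add: distrib_left mult.commute)
  qed
  finally have dual: "inner mu' (c y) \<le> inner mu (c y) + 5 / (4 * \<rho>) * \<delta> + \<rho> / 4 * E"
    by (simp add: inner_diff_left)
  have "(3 / 4 * \<rho>) * E \<le> (3 / 4 * \<rho>) * (L_c\<^sup>2 * D)"
    using E \<open>\<rho> > 0\<close> by (intro mult_left_mono) auto
  also have "\<dots> = (3 / 4 * (\<rho> * L_c\<^sup>2)) * D" by simp
  also have "\<dots> \<le> (\<eta> - L_p / 2) * D"
    using \<eta> sq \<open>L_p \<ge> 0\<close> \<open>D \<ge> 0\<close> by (intro mult_right_mono) linarith+
  finally have absorb: "3 / 4 * \<rho> * E \<le> (\<eta> - L_p / 2) * D" .
  show ?thesis
    unfolding augmented_lagrangian_def using primal square lam_x dual absorb by simp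
qed

section \<open>Sequences and sublevel sets\<close>

text \<open>Subtracting the accumulated errors turns the sequence into a decreasing one.\<close>

lemma convergent_if_almost_decreasing:
  fixes a e :: "nat \<Rightarrow> real"
  assumes step: "\<And>k. a (Suc k) \<le> a k + e k" and "\<And>k. 0 \<le> e k" and "summable e"
    and below: "\<And>k. m \<le> a k"
  shows "convergent a"
proof -
  define s where "s k = (\<Sum>j<k. e j)" for k
  have "s k \<le> suminf e" for k
    unfolding s_def using assms(2) by (intro sum_le_suminf \<open>summable e\<close>) auto
  moreover have "decseq (\<lambda>k. a k - s k)"
    by (rule decseq_SucI) (use step in \<open>simp add: s_def algebra_simps\<close>)
  ultimately obtain l where "(\<lambda>k. a k - s k) \<longlonglongrightarrow> l"
    using decseq_convergent[of "\<lambda>k. a k - s k" "m - suminf e"] below by (meson diff_mono)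
  moreover have "s \<longlonglongrightarrow> suminf e"
    unfolding s_def by (rule summable_LIMSEQ[OF \<open>summable e\<close>])
  ultimately have "(\<lambda>k. (a k - s k) + s k) \<longlonglongrightarrow> l + suminf e" by (rule tendsto_add)
  then show ?thesis by (auto simp: convergent_def)
qed

lemma norm_le_if_summable_increments:
  fixes v :: "nat \<Rightarrow> 'a::real_normed_vector"
  assumes step: "\<And>k. norm (v (Suc k) - v k) \<le> e k" and "summable e"
  shows "norm (v k) \<le> norm (v 0) + suminf e"
proof -
  have "norm (v k - v 0) = norm (\<Sum>j<k. v (Suc j) - v j)" by (simp add: sum_lessThan_telescope)
  also have "\<dots> \<le> (\<Sum>j<k. e j)" by (rule sum_norm_le) (rule step)
  also have "\<dots> \<le> suminf e"
    by (rule sum_le_suminf[OF \<open>summable e\<close>]) (use step norm_ge_zero order_trans in \<open>blast+\<close>)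
  finally show ?thesis using norm_triangle_ineq2[of "v k" "v 0"] by linarith
qed

lemma bounded_sublevel_set_if_coercive:
  assumes "coercive_on X f"
  shows "bounded {x \<in> X. f x \<le> b}"
proof -
  have "eventually (\<lambda>x. b < f x) (inf at_infinity (principal X))"
    using assms unfolding coercive_on_def filterlim_at_top_dense by blast
  then obtain R where "\<And>x. R \<le> norm x \<Longrightarrow> x \<in> X \<Longrightarrow> b < f x"
    unfolding eventually_inf_principal eventually_at_infinity by blast
  then have "norm x \<le> R" if "x \<in> {x \<in> X. f x \<le> b}" for x
    using that by (metis (mono_tags, lifting) linorder_le_cases mem_Collect_eq not_le)
  then show ?thesis by (rule boundedI)
qed

lemma bounded_range_if_bounded_tail:
  fixes v :: "nat \<Rightarrow> 'a::real_normed_vector"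
  assumes "bounded (range (\<lambda>k. v (Suc k)))"
  shows "bounded (range v)"
proof -
  have "range v \<subseteq> insert (v 0) (range (\<lambda>k. v (Suc k)))"
  proof (rule image_subsetI)
    fix k show "v k \<in> insert (v 0) (range (\<lambda>k. v (Suc k)))" by (cases k) auto
  qed
  moreover have "bounded (insert (v 0) (range (\<lambda>k. v (Suc k))))" using assms by simp
  ultimately show ?thesis by (rule bounded_subset[rotated])
qed

section \<open>Convergence of the Lagrangian values\<close>

theorem theorem1:
  fixes f :: "real^'n \<Rightarrow> real"
    and c :: "real^'n \<Rightarrow> real^'m"
    and X :: "(real^'n) set"
    and L_gf L_jc L_c L_p \<alpha> \<beta> \<eta> r :: real
    and \<delta> :: "nat \<Rightarrow> real"
    and x :: "nat \<Rightarrow> real^'n"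
    and z lam mu :: "nat \<Rightarrow> real^'m"
  assumes f_C1: "C1_scalar f"
    and c_C1: "C1_vector c"
    and X: "X \<noteq> {}" "closed X" "convex X"
    and A1: "L_gf-lipschitz_on X (gradient f)"
    and A2: "jacobian_lipschitz_on L_jc X c"
    and A3: "L_c-lipschitz_on X c"
    and A4: "bounded X \<or> (coercive_on X f \<and> bdd_below (f ` X))"
    and \<alpha>: "\<alpha> > 1"
    and \<beta>: "0 < \<beta>" "\<beta> < 1"
    and L_p: "L_p > 0"
      "\<And>k. L_p-lipschitz_on X (\<lambda>y. grad_x_lagrangian f c \<alpha> \<beta> y (z k) (lam k) (mu k))"
    and \<eta>: "\<eta> > L_p + 2 * pp_rho \<alpha> \<beta> * L_c\<^sup>2"
    and r: "0 < r" "r < 1"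
    and \<delta>0: "0 < \<delta> 0" "\<delta> 0 \<le> 1"
    and iterates: "pp_iterates f c X \<alpha> \<beta> \<eta> r \<delta> x z lam mu"
  shows "(\<exists>L_inf::real. (\<lambda>k. pp_lagrangian f c \<alpha> \<beta> (x k) (z k) (lam k) (mu k)) \<longlonglongrightarrow> L_inf) \<and>
         bounded (range (\<lambda>k. (x k, z k, lam k, mu k)))"
proof -
  define \<rho> where "\<rho> = pp_rho \<alpha> \<beta>"
  have "\<rho> > 0" unfolding \<rho>_def using \<alpha> \<beta> by (intro pp_rho_pos) auto
  have upd:
      "x (Suc k) = closest_point X
        (x k - (1 / \<eta>) *\<^sub>R grad_x_lagrangian f c \<alpha> \<beta> (x k) (z k) (lam k) (mu k))"
      "mu (Suc k) = mu k + (\<delta> k / ((norm (lam k - mu k))\<^sup>2 + 1)) *\<^sub>R (lam k - mu k)"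
      "lam (Suc k) = mu (Suc k) + \<rho> *\<^sub>R c (x (Suc k))"
      "z (Suc k) = (1 / \<alpha>) *\<^sub>R (lam (Suc k) - mu (Suc k))"
      "\<delta> (Suc k) = r * \<delta> k" for k
    using iterates \<open>\<rho> > 0\<close> unfolding pp_iterates_def Let_def \<rho>_def[symmetric] by auto
  have f: "\<And>u. f differentiable (at u)" and c: "\<And>u. c differentiable (at u)"
    using f_C1 c_C1 by (auto simp: C1_scalar_def C1_vector_def)
  have \<delta>_eq: "\<delta> k = \<delta> 0 * r ^ k" for k by (induction k) (simp_all add: upd(5))
  have \<delta>_nonneg: "0 \<le> \<delta> k" for k using \<delta>0 r by (subst \<delta>_eq) simp
  have \<delta>_le: "\<delta> k \<le> 1" for k
    using \<delta>0 r by (subst \<delta>_eq) (simp add: mult_le_one power_le_one)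
  have \<delta>_summable: "summable \<delta>"
    using r by (subst \<delta>_eq[abs_def]) (intro summable_mult summable_geometric, simp)
  have x_in: "x (Suc k) \<in> X" for k unfolding upd(1) by (rule closest_point_in_set[OF X(2,1)])

  have "norm (mu (Suc k) - mu k) \<le> \<delta> k" for k
  proof -
    have "norm (mu (Suc k) - mu k)
        = \<delta> k * (norm (lam k - mu k) / ((norm (lam k - mu k))\<^sup>2 + 1))"
      using \<delta>_nonneg[of k] by (simp add: upd(2) abs_of_nonneg)
    also have "\<dots> \<le> \<delta> k * 1"
      using norm_normalised_le[of "lam k - mu k"] \<delta>_nonneg[of k]
      by (intro mult_left_mono) linarith+
    finally show ?thesis by simp
  qed
  then obtain M where M: "\<And>k. norm (mu k) \<le> M"
    using norm_le_if_summable_increments[OF _ \<delta>_summable, of mu] by blast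

  define \<Phi> where "\<Phi> k = augmented_lagrangian f c \<rho> (x (Suc k)) (mu (Suc k))" for k
  have L_eq: "pp_lagrangian f c \<alpha> \<beta> (x (Suc k)) (z (Suc k)) (lam (Suc k)) (mu (Suc k)) = \<Phi> k" for k
    unfolding \<Phi>_def \<rho>_def using \<alpha> \<beta> upd(3,4)
    by (intro pp_lagrangian_eq_augmented) (auto simp: \<rho>_def)
  have step: "\<Phi> (Suc k) \<le> \<Phi> k + 5 / (4 * \<rho>) * \<delta> (Suc k)" for k
    unfolding \<Phi>_def
    by (rule augmented_lagrangian_step[OF X(3,2) x_in f c A3 L_p(2) \<open>\<rho> > 0\<close> \<eta>[folded \<rho>_def]
          \<delta>_nonneg \<delta>_le upd(3) upd(1) upd(2)])
  have f_le: "f (x (Suc k)) \<le> \<Phi> k + M\<^sup>2 / (2 * \<rho>)" for k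
  proof -
    have "(norm (mu (Suc k)))\<^sup>2 / (2 * \<rho>) \<le> M\<^sup>2 / (2 * \<rho>)"
      using M[of "Suc k"] \<open>\<rho> > 0\<close> by (intro divide_right_mono power_mono) auto
    then show ?thesis
      using augmented_lagrangian_ge[OF \<open>\<rho> > 0\<close>, of f "x (Suc k)" "mu (Suc k)" c]
      unfolding \<Phi>_def by linarith
  qed
  have "bdd_below (f ` X)"
  proof (cases "bounded X")
    case True
    then have "compact X" using X(2) by (simp add: compact_eq_bounded_closed)
    moreover have "continuous_on X f"
      using f by (meson continuous_at_imp_continuous_on differentiable_imp_continuous_within)
    ultimately show ?thesis
      by (intro bounded_imp_bdd_below compact_imp_bounded compact_continuous_image)
  next
    case False
    then show ?thesis using A4 by simp
  qed
  then obtain m where m: "\<And>u. u \<in> X \<Longrightarrow> m \<le> f u" by (auto simp: bdd_below_def)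
  have below: "m - M\<^sup>2 / (2 * \<rho>) \<le> \<Phi> k" for k using f_le[of k] m[OF x_in[of k]] by linarith
  have errors_summable: "summable (\<lambda>k. 5 / (4 * \<rho>) * \<delta> (Suc k))"
    using \<delta>_summable by (intro summable_mult) (simp add: summable_Suc_iff)
  have errors_nonneg: "0 \<le> 5 / (4 * \<rho>) * \<delta> (Suc k)" for k using \<open>\<rho> > 0\<close> \<delta>_nonneg by simp
  have "convergent \<Phi>"
    by (rule convergent_if_almost_decreasing[OF step errors_nonneg errors_summable below])
  then obtain L where "\<Phi> \<longlonglongrightarrow> L" by (auto simp: convergent_def)
  \<comment> \<open>The identification with \<open>\<Phi>\<close> relies on the updates of \<open>lam\<close> and \<open>z\<close>, which the initial
    point need not satisfy.\<close>
  then have lim: "(\<lambda>k. pp_lagrangian f c \<alpha> \<beta> (x k) (z k) (lam k) (mu k)) \<longlonglongrightarrow> L"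
    by (subst filterlim_sequentially_Suc[symmetric]) (simp add: L_eq)

  obtain B where B: "\<And>k. \<Phi> k \<le> B"
    using convergent_imp_Bseq[OF \<open>convergent \<Phi>\<close>] unfolding Bseq_def by (metis abs_le_D1 real_norm_def)
  have x_bdd: "bounded (range (\<lambda>k. x (Suc k)))"
  proof (cases "bounded X")
    case True
    then show ?thesis by (rule bounded_subset) (use x_in in auto)
  next
    case False
    have "f (x (Suc k)) \<le> B + M\<^sup>2 / (2 * \<rho>)" for k using f_le[of k] B[of k] by linarith
    then have "range (\<lambda>k. x (Suc k)) \<subseteq> {u \<in> X. f u \<le> B + M\<^sup>2 / (2 * \<rho>)}" using x_in by auto
    moreover have "coercive_on X f" using A4 False by simp
    ultimately show ?thesis by (intro bounded_subset[OF bounded_sublevel_set_if_coercive])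
  qed
  have "bounded (c ` range (\<lambda>k. x (Suc k)))"
    using x_bdd x_in by (intro bounded_uniformly_continuous_image
        lipschitz_on_uniformly_continuous[OF lipschitz_on_subset[OF A3]]) auto
  then have c_bdd: "bounded (range (\<lambda>k. c (x (Suc k))))" by (simp add: image_image)
  have mu_bdd: "bounded (range (\<lambda>k. mu (Suc k)))" using M by (auto intro: boundedI)
  have lam_bdd: "bounded (range (\<lambda>k. lam (Suc k)))"
    unfolding upd(3) using mu_bdd c_bdd by (intro bounded_plus_comp bounded_scaleR_comp)
  have z_bdd: "bounded (range (\<lambda>k. z (Suc k)))"
    unfolding upd(4) using lam_bdd mu_bdd by (intro bounded_minus_comp bounded_scaleR_comp)
  have "bounded (range (\<lambda>k. x (Suc k)) \<times> range (\<lambda>k. z (Suc k)) \<times>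
      range (\<lambda>k. lam (Suc k)) \<times> range (\<lambda>k. mu (Suc k)))"
    by (intro bounded_Times x_bdd z_bdd lam_bdd mu_bdd)
  then have "bounded (range (\<lambda>k. (x (Suc k), z (Suc k), lam (Suc k), mu (Suc k))))"
    by (rule bounded_subset) auto
  then have "bounded (range (\<lambda>k. (x k, z k, lam k, mu k)))" by (rule bounded_range_if_bounded_tail)
  with lim show ?thesis by blast
qed

end
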